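(* Let $i,j\ge 1$ be integers with $N:=i+j$ even, and let $p,q$ be relatively prime positive integers with $p<q$. Let $p'$ be an integer with $p'p\equiv 1\pmod q$. Then $$R(i,j)\,q^{N-2}\,s_{ij}(p,q)\;-\;\frac{p'^{\,i}\,\alpha_N r_N\binom{N-1}{i}+p^{\,j}\,\alpha_N r_N\binom{N-1}{j}}{q}$$ is an integer, where $R(i,j):=\binom{N}{i}\beta_N r_N$.
   Context: Bernoulli numbers $B_k$ are defined by $\frac{z}{e^z-1}=\sum_{k\ge0}\frac{B_k}{k!}z^k$ (so $B_1=-\tfrac12$), and Bernoulli polynomials by $\frac{ze^{xz}}{e^z-1}=\sum_k \frac{B_k(x)}{k!}z^k$. For real $x$, $\langle x\rangle=x-\lfloor x\rfloor\in[0,1)$. The periodic Bernoulli function $\bar B_k$ is $\bar B_k(x)=B_k(\langle x\rangle)$ for $x\notin\mathbb Z$, $\bar B_k(x)=B_k$ for $k\ge2$ and $x\in\mathbb Z$, and $\bar B_1(x)=0$ for $x\in\mathbb Z$. The generalized Dedekind sum is $s_{ij}(p,q)=\sum_{k=0}^{q-1}\bar B_i\!\left(\tfrac kq\right)\bar B_j\!\left(\tfrac{pk}{q}\right)$. For even $N$, write $B_N=\alpha_N/\beta_N$ in lowest terms with $\beta_N>0$, and let $r_N$ be the least common multiple of the denominators of the rational numbers $\beta_N\binom{N}{i+1}B_{i+1}B_{N-i-1}$ over all odd $i$ with $0\le i\le N-2$ (an empty lcm being $1$). *)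

theory Defs
  imports
    Complex_Main
    "HOL-Computational_Algebra.Formal_Power_Series"
    "HOL-Number_Theory.Cong"
begin

definition bernoulli_num :: "nat \<Rightarrow> rat" where
  "bernoulli_num k = fact k * fps_nth (fps_X / (fps_exp 1 - 1)) k"

definition bernoulli_poly :: "nat \<Rightarrow> real \<Rightarrow> real" where
  "bernoulli_poly k x = fact k * fps_nth (fps_X * fps_exp x / (fps_exp 1 - 1)) k"

text \<open>
  Division of formal power series is exact here, since the numerator is divisible by
  \<open>fps_X\<close> and the denominator has subdegree 1; the quotients are therefore the
  generating functions in the usual sense.
\<close>

lemma fps_exp_minus_1_dvd:
  "fps_exp (1 :: 'a :: field_char_0) - 1 dvd fps_X * f"
proof -
  have "subdegree (fps_exp (1 :: 'a) - 1) = 1"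
    by (rule subdegreeI) auto
  moreover have "subdegree (fps_X * f) \<ge> 1" if "f \<noteq> 0"
    using that by simp
  moreover have "fps_exp (1 :: 'a) - 1 \<noteq> 0"
    using calculation(1) by (metis subdegree_0 zero_neq_one)
  ultimately show ?thesis
    by (cases "f = 0") (auto simp: fps_dvd_iff)
qed

lemma bernoulli_num_gf:
  "Abs_fps (\<lambda>k. bernoulli_num k / fact k) * (fps_exp 1 - 1) = fps_X"
proof -
  have "Abs_fps (\<lambda>k. bernoulli_num k / fact k) = fps_X / (fps_exp 1 - 1)"
    by (simp add: bernoulli_num_def fps_eq_iff)
  then show ?thesis
    using fps_exp_minus_1_dvd[of "1 :: rat fps"] by simp
qed

lemma bernoulli_poly_gf:
  "Abs_fps (\<lambda>k. bernoulli_poly k x / fact k) * (fps_exp 1 - 1) = fps_X * fps_exp x"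
proof -
  have "Abs_fps (\<lambda>k. bernoulli_poly k x / fact k) = fps_X * fps_exp x / (fps_exp 1 - 1)"
    by (simp add: bernoulli_poly_def fps_eq_iff)
  then show ?thesis
    using fps_exp_minus_1_dvd[of "fps_exp x"] by simp
qed

text \<open>The value for \<open>k = 0\<close> is never used below; it is the constant \<open>1\<close>.\<close>

definition periodic_bernoulli :: "nat \<Rightarrow> real \<Rightarrow> real" where
  "periodic_bernoulli k x =
     (if x \<notin> \<int> then bernoulli_poly k (frac x)
      else if k = 1 then 0
      else of_rat (bernoulli_num k))"

definition gen_dedekind_sum :: "nat \<Rightarrow> nat \<Rightarrow> nat \<Rightarrow> nat \<Rightarrow> real" where
  "gen_dedekind_sum i j p q =
     (\<Sum>k = 0..<q. periodic_bernoulli i (real k / real q) *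
                   periodic_bernoulli j (real (p * k) / real q))"

text \<open>\<open>quotient_of\<close> returns the fraction in lowest terms with positive denominator.\<close>

definition bern_numer :: "nat \<Rightarrow> int" where
  "bern_numer N = fst (quotient_of (bernoulli_num N))"

definition bern_denom :: "nat \<Rightarrow> int" where
  "bern_denom N = snd (quotient_of (bernoulli_num N))"

text \<open>The bound \<open>i \<le> N - 2\<close> is written without truncated subtraction; \<open>Lcm {} = 1\<close>.\<close>

definition bern_lcm :: "nat \<Rightarrow> int" where
  "bern_lcm N =
     Lcm {snd (quotient_of (of_int (bern_denom N) * of_nat (N choose (i + 1)) *
                            bernoulli_num (i + 1) * bernoulli_num (N - i - 1)))
          | i. odd i \<and> i + 2 \<le> N}"

definition dedekind_R :: "nat \<Rightarrow> nat \<Rightarrow> int" where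
  "dedekind_R i j = int ((i + j) choose i) * bern_denom (i + j) * bern_lcm (i + j)"

end

theory Submission
  imports Defs
begin

text \<open>
  The numbers \<open>binom(N,i) s_ij(p,q)\<close> with \<open>i + j = N\<close> are, up to sign, the coefficients of a binary
  form (\<open>dedekind_form\<close>), which after division by the product of its two variables is the degree
  \<open>N - 2\<close> part of the lattice point generating function of the cone spanned by \<open>(1,0)\<close> and \<open>(p,q)\<close>.
  Cutting the positive quadrant along the ray through \<open>(p,q)\<close> gives a reciprocity law, whose right
  hand side becomes integral after multiplication by \<open>\<beta>\<^sub>N r\<^sub>N\<close>, apart from the two terms with
  coefficient \<open>\<alpha>\<^sub>N r\<^sub>N\<close>.  Together with periodicity in \<open>p\<close>, the Euclidean algorithm shows that
  \<open>\<beta>\<^sub>N r\<^sub>N\<close> times the form is integral in the coordinates of the lattice, except for polar terms at the two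
  boundary rays: at interior rays they cancel because \<open>N - 1\<close> is odd.  Passing from lattice
  coordinates to the coordinates along the two rays costs the factor \<open>q ^ (N - 2)\<close> and turns the polar
  terms into the stated fraction.
\<close>

subsection \<open>Bernoulli numbers and polynomials\<close>

text \<open>A series in two variables is encoded as a series in \<open>fps_X\<close> with real
  parameters: \<open>u\<close> scales \<open>fps_X\<close>, and the \<open>N\<close>-th coefficient
  of a product of two such series is, up to \<open>fact N\<close>, a binary form of degree
  \<open>N\<close> in the two parameters.\<close>

definition bern_gf :: "real \<Rightarrow> real \<Rightarrow> real fps" where
  "bern_gf x u = Abs_fps (\<lambda>k. bernoulli_poly k x * u ^ k / fact k)"

lemma bern_gf_mult_exp:
  "bern_gf x u * (fps_exp u - 1) = fps_const u * fps_X * fps_exp (x * u)"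
proof -
  let ?l = "fps_const u * fps_X :: real fps"
  have "(Abs_fps (\<lambda>k. bernoulli_poly k x / fact k) * (fps_exp 1 - 1)) oo ?l
          = (fps_X * fps_exp x) oo ?l"
    by (simp only: bernoulli_poly_gf)
  moreover have "Abs_fps (\<lambda>k. bernoulli_poly k x / fact k) oo ?l = bern_gf x u"
    by (simp add: fps_compose_linear bern_gf_def fps_eq_iff)
  moreover have "fps_exp c oo ?l = fps_exp (c * u)" for c
    by (simp add: fps_compose_linear fps_eq_iff power_mult_distrib)
  ultimately show ?thesis
    by (simp add: fps_compose_mult_distrib fps_compose_sub_distrib)
qed

lemma fps_exp_minus_1_nonzero: "u \<noteq> 0 \<Longrightarrow> fps_exp (u :: real) - 1 \<noteq> 0"
  by (auto simp: fps_eq_iff intro!: exI[of _ 1])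

lemma bern_gf_eqI:
  assumes "f * (fps_exp 1 - 1) = fps_X * fps_exp x"
  shows "f = bern_gf x 1"
proof -
  have "f * (fps_exp 1 - 1) = bern_gf x 1 * (fps_exp 1 - 1)"
    using assms by (simp add: bern_gf_mult_exp)
  then show ?thesis
    using fps_exp_minus_1_nonzero[of 1] by simp
qed

text \<open>The rational generating function, mapped coefficientwise into the reals, satisfies the
  equation that characterises \<open>bern_gf 0 1\<close>.\<close>

lemma bernoulli_poly_0: "bernoulli_poly k 0 = of_rat (bernoulli_num k)"
proof -
  have of_rat_fact [simp]: "of_rat (fact m) = (fact m :: real)" for m
    by (metis of_rat_of_nat_eq of_nat_fact)
  let ?b = "Abs_fps (\<lambda>k. of_rat (bernoulli_num k) / fact k) :: real fps"
  have "?b * (fps_exp 1 - 1) = fps_X * fps_exp 0"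
  proof (rule fps_ext)
    fix n
    have "of_rat (fps_nth (Abs_fps (\<lambda>k. bernoulli_num k / fact k) * (fps_exp 1 - 1)) n)
            = fps_nth (?b * (fps_exp 1 - 1)) n"
      by (simp add: fps_mult_nth of_rat_sum of_rat_mult of_rat_divide of_rat_diff
          if_distrib[of of_rat] cong: if_cong)
    then show "fps_nth (?b * (fps_exp 1 - 1)) n = fps_nth (fps_X * fps_exp 0) n"
      unfolding bernoulli_num_gf by (cases "n = 1") simp_all
  qed
  then have "?b = bern_gf 0 1"
    by (rule bern_gf_eqI)
  from arg_cong[OF this, of "\<lambda>f. fps_nth f k"] show ?thesis
    by (simp add: bern_gf_def)
qed

text \<open>Multiplying numerator and denominator of \<open>-X e^(-xX) / (e^(-X) - 1)\<close> by
  \<open>e^X\<close> turns it into \<open>X e^((1-x)X) / (e^X - 1)\<close>.\<close>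

lemma bernoulli_poly_reflect: "bernoulli_poly k (1 - x) = (-1) ^ k * bernoulli_poly k x"
proof -
  have e: "fps_exp (1::real) * fps_exp (-1) = 1"
    by (simp flip: fps_exp_add_mult)
  have "bern_gf x (-1) * (fps_exp 1 - 1)
          = - (bern_gf x (-1) * (fps_exp (-1) - 1)) * fps_exp 1"
    using e by (simp add: algebra_simps)
  also have "\<dots> = fps_X * (fps_exp (-x) * fps_exp 1)"
    by (simp add: bern_gf_mult_exp mult_ac flip: fps_const_neg)
  also have "\<dots> = fps_X * fps_exp (1 - x)"
    by (simp flip: fps_exp_add_mult)
  finally have "bern_gf x (-1) = bern_gf (1 - x) 1"
    by (rule bern_gf_eqI)
  from arg_cong[OF this, of "\<lambda>f. fps_nth f k"] show ?thesis
    by (simp add: bern_gf_def mult.commute)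
qed

lemma bernoulli_poly_1: "bernoulli_poly k 1 = bernoulli_poly k 0 + (if k = 1 then 1 else 0)"
proof -
  have "(bern_gf 0 1 + fps_X) * (fps_exp 1 - 1) = fps_X * fps_exp 1"
    using bern_gf_mult_exp[of 0 1] by (simp add: algebra_simps)
  then have "bern_gf 0 1 + fps_X = bern_gf 1 1"
    by (rule bern_gf_eqI)
  from arg_cong[OF this, of "\<lambda>f. fps_nth f k"] show ?thesis
    by (simp add: bern_gf_def fps_X_def split: if_splits)
qed

lemma bernoulli_num_1: "bernoulli_num 1 = - 1 / 2"
proof -
  have "bernoulli_poly 1 0 = - (1 / 2 :: real)"
    using bernoulli_poly_reflect[of 1 0] bernoulli_poly_1[of 1] by simp
  then have "(of_rat (bernoulli_num 1) :: real) = of_rat (- 1 / 2)"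
    by (simp add: bernoulli_poly_0 of_rat_divide of_rat_minus)
  then show ?thesis
    by (simp only: of_rat_eq_iff)
qed

text \<open>Reflection at 0 gives \<open>B_k(1) = - B_k(0)\<close> for odd \<open>k\<close>, while
  \<open>B_k(1) = B_k(0)\<close> unless \<open>k = 1\<close>.\<close>

lemma bernoulli_num_odd:
  assumes "odd k" "k \<noteq> 1"
  shows "bernoulli_num k = 0"
proof -
  have "bernoulli_poly k 0 = 0"
    using bernoulli_poly_reflect[of k 0] bernoulli_poly_1[of k] assms by simp
  then show ?thesis
    by (simp add: bernoulli_poly_0)
qed

lemma bernoulli_num_0: "bernoulli_num 0 = 1"
  using arg_cong[OF bernoulli_num_gf, of "\<lambda>f. fps_nth f 1"]
  by (simp add: fps_mult_nth)

lemma bernoulli_num_2: "bernoulli_num 2 = 1 / 6"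
proof -
  have "fps_nth (Abs_fps (\<lambda>k. bernoulli_num k / fact k) * (fps_exp 1 - 1)) 3 = 0"
    by (simp add: bernoulli_num_gf)
  then show ?thesis
    by (simp add: fps_mult_nth numeral_3_eq_3 numeral_2_eq_2 bernoulli_num_0
        bernoulli_num_1[simplified] fact_numeral field_simps)
qed

subsection \<open>Lattice points in the two halves of the quadrant\<close>

lemma sum_power_atLeastLessThan:
  fixes X :: "'a :: comm_ring_1"
  assumes "c \<le> n"
  shows "(1 - X) * (\<Sum>m = c..<n. X ^ m) = X ^ c - X ^ n"
  using assms by (induction n rule: dec_induct) (simp_all add: distrib_left left_diff_distrib)

text \<open>
  The rectangle \<open>[0,p) \<times> [0,q)\<close> is covered by the lattice points on or below and on or above
  its diagonal, which meet only in the origin because \<open>p\<close> and \<open>q\<close> are coprime.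
\<close>

lemma lattice_cone_identity:
  fixes X Y :: "'a :: comm_ring_1"
  assumes p: "p > 0" and q: "q > 0" and cop: "coprime p q"
  shows "(1 - Y) * (\<Sum>n<q. X ^ nat \<lceil>real (p * n) / real q\<rceil> * Y ^ n)
       + (1 - X) * (\<Sum>m<p. Y ^ nat \<lceil>real (q * m) / real p\<rceil> * X ^ m)
       = 1 - X ^ p * Y ^ q + (1 - X) * (1 - Y)"
proof -
  \<comment> \<open>In row \<open>n\<close> the points on or below the diagonal start at
    \<open>m = ceil (p n / q)\<close>, so the inner sum is geometric. The claim is stated for
    arbitrary \<open>p\<close>, \<open>q\<close>, \<open>X\<close>, \<open>Y\<close> so that
    exchanging the axes gives the other half.\<close>
  have half: "(1 - X) * (1 - Y) * (\<Sum>n<q. \<Sum>m<p. if p * n \<le> q * m then X ^ m * Y ^ n else 0)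
      = (1 - Y) * (\<Sum>n<q. X ^ nat \<lceil>real (p * n) / real q\<rceil> * Y ^ n) - X ^ p * (1 - Y ^ q)"
    if p: "p > 0" and q: "q > 0" for p q :: nat and X Y :: 'a
  proof -
    have inner: "(1 - X) * (\<Sum>m<p. if p * n \<le> q * m then X ^ m * Y ^ n else 0)
            = X ^ nat \<lceil>real (p * n) / real q\<rceil> * Y ^ n - X ^ p * Y ^ n" if n: "n < q" for n
    proof -
      let ?c = "nat \<lceil>real (p * n) / real q\<rceil>"
      have c: "?c \<le> m \<longleftrightarrow> p * n \<le> q * m" for m
      proof -
        have "?c \<le> m \<longleftrightarrow> real (p * n) / real q \<le> real m"
          by (simp add: nat_le_iff ceiling_le_iff)
        also have "\<dots> \<longleftrightarrow> real (p * n) \<le> real (q * m)"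
          using q by (simp add: field_simps)
        finally show ?thesis
          by (simp only: of_nat_le_iff)
      qed
      have "?c \<le> p"
        using n by (simp only: c) (simp add: mult.commute)
      have "(\<Sum>m<p. if p * n \<le> q * m then X ^ m * Y ^ n else 0)
              = (\<Sum>m\<in>{m\<in>{..<p}. p * n \<le> q * m}. X ^ m * Y ^ n)"
        by (rule sum.inter_filter[symmetric]) simp
      also have "{m\<in>{..<p}. p * n \<le> q * m} = {?c..<p}"
        by (auto simp flip: c)
      finally have eq: "(1 - X) * (\<Sum>m<p. if p * n \<le> q * m then X ^ m * Y ^ n else 0)
              = ((1 - X) * (\<Sum>m = ?c..<p. X ^ m)) * Y ^ n"
        by (simp only: sum_distrib_right mult.assoc)
      show ?thesis
        unfolding eq sum_power_atLeastLessThan[OF \<open>?c \<le> p\<close>] by (rule left_diff_distrib)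
    qed
    have "(1 - X) * (1 - Y) * (\<Sum>n<q. \<Sum>m<p. if p * n \<le> q * m then X ^ m * Y ^ n else 0)
            = (1 - Y) * (\<Sum>n<q. (1 - X) * (\<Sum>m<p. if p * n \<le> q * m then X ^ m * Y ^ n else 0))"
      by (simp only: sum_distrib_left[symmetric] mult_ac)
    also have "\<dots> = (1 - Y) * (\<Sum>n<q. X ^ nat \<lceil>real (p * n) / real q\<rceil> * Y ^ n - X ^ p * Y ^ n)"
      using inner by simp
    also have "\<dots> = (1 - Y) * (\<Sum>n<q. X ^ nat \<lceil>real (p * n) / real q\<rceil> * Y ^ n)
                   - X ^ p * ((1 - Y) * (\<Sum>n<q. Y ^ n))"
      by (simp add: sum_subtractf sum_distrib_left algebra_simps)
    also have "(1 - Y) * (\<Sum>n<q. Y ^ n) = 1 - Y ^ q"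
      using sum_power_atLeastLessThan[of 0 q Y] by (simp add: atLeast0LessThan)
    finally show ?thesis .
  qed
  define A where "A = (\<Sum>n<q. \<Sum>m<p. if p * n \<le> q * m then X ^ m * Y ^ n else 0)"
  define B where "B = (\<Sum>m<p. \<Sum>n<q. if q * m \<le> p * n then Y ^ n * X ^ m else 0)"
  have diag: "p * n = q * m \<longleftrightarrow> n = 0 \<and> m = 0" if "n < q" "m < p" for n m
  proof
    assume e: "p * n = q * m"
    then have "q dvd n"
      using cop by (metis coprime_commute coprime_dvd_mult_right_iff dvd_triv_left)
    then have "n = 0"
      using that by (meson nat_dvd_not_less neq0_conv)
    then show "n = 0 \<and> m = 0"
      using e q by simp
  qed simp
  have "A + B = (\<Sum>n<q. \<Sum>m<p. (if p * n \<le> q * m then X ^ m * Y ^ n else 0)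
                  + (if q * m \<le> p * n then Y ^ n * X ^ m else 0))"
    unfolding A_def B_def by (subst (2) sum.swap) (simp add: sum.distrib)
  \<comment> \<open>Every point of the rectangle lies in one of the halves and only the origin in
    both, hence the extra 1 there.\<close>
  also have "\<dots> = (\<Sum>n<q. \<Sum>m<p. Y ^ n * X ^ m + (if n = 0 then if m = 0 then 1 else 0 else 0))"
  proof (intro sum.cong refl)
    fix n m assume "n \<in> {..<q}" "m \<in> {..<p}"
    then show "(if p * n \<le> q * m then X ^ m * Y ^ n else 0)
                  + (if q * m \<le> p * n then Y ^ n * X ^ m else 0)
               = Y ^ n * X ^ m + (if n = 0 then if m = 0 then 1 else 0 else 0)"
      using diag[of n m] by (auto simp: mult.commute)
  qed
  also have "\<dots> = (\<Sum>n<q. Y ^ n) * (\<Sum>m<p. X ^ m)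
                 + (\<Sum>n<q. if n = 0 then \<Sum>m<p. if m = 0 then 1 else 0 else 0)"
    unfolding sum.distrib sum_product
    by (intro arg_cong2[of _ _ _ _ "(+)"] sum.cong refl) (auto intro!: sum.neutral)
  also have "(\<Sum>n<q. if n = 0 then \<Sum>m<p. if m = 0 then 1 else (0 :: 'a) else 0) = 1"
    using p q by (simp add: sum.delta)
  finally have AB: "A + B = (\<Sum>n<q. Y ^ n) * (\<Sum>m<p. X ^ m) + 1" .
  have "(1 - X) * (1 - Y) * A + (1 - Y) * (1 - X) * B
          = ((1 - Y) * (\<Sum>n<q. Y ^ n)) * ((1 - X) * (\<Sum>m<p. X ^ m)) + (1 - X) * (1 - Y)"
    using arg_cong[OF AB, of "\<lambda>s. (1 - X) * (1 - Y) * s"] by (simp add: algebra_simps)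
  also have "\<dots> = (1 - Y ^ q) * (1 - X ^ p) + (1 - X) * (1 - Y)"
    using sum_power_atLeastLessThan[of 0 q Y] sum_power_atLeastLessThan[of 0 p X]
    by (simp add: atLeast0LessThan)
  finally show ?thesis
    unfolding A_def B_def half[OF p q] half[OF q p] by (simp add: algebra_simps)
qed

subsection \<open>The reciprocity law\<close>

lemma bern_gf_mult_nth:
  "fact N * fps_nth (bern_gf a x * bern_gf b y) N
     = (\<Sum>i\<le>N. real (N choose i) * (bernoulli_poly i a * bernoulli_poly (N - i) b)
              * x ^ i * y ^ (N - i))"
  unfolding fps_mult_nth sum_distrib_left bern_gf_def atLeast0AtMost
  by (intro sum.cong refl) (simp add: binomial_fact)

text \<open>Here \<open>x\<close>, \<open>z\<close>, \<open>y\<close> are the values of a linear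
  functional at \<open>(1,0)\<close>, \<open>(0,1)\<close>, \<open>(p,q)\<close>. In
  \<open>lattice_cone_identity\<close> put \<open>X = fps_exp x\<close> and
  \<open>Y = fps_exp z\<close>, so that \<open>X ^ p * Y ^ q = fps_exp y\<close>, and clear the
  denominators. The last term comes from the ray through \<open>(p,q)\<close>, which both cones
  contain.\<close>

lemma bern_gf_reciprocity:
  fixes p q :: nat and x z :: real
  assumes p: "p > 0" and q: "q > 0" and cop: "coprime p q" and x: "x > 0" and z: "z > 0"
  defines "y \<equiv> real p * x + real q * z"
  shows "fps_const z * (\<Sum>n<q. bern_gf (frac (- (real (p * n) / real q))) x * bern_gf (real n / real q) y)
       + fps_const x * (\<Sum>m<p. bern_gf (frac (- (real (q * m) / real p))) z * bern_gf (real m / real p) y)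
       = fps_const y * (bern_gf 0 x * bern_gf 0 z) - fps_const (x * z) * fps_X * bern_gf 0 y"
proof -
  \<comment> \<open>The lattice points of the half-open parallelogram on \<open>(1,0)\<close> and
    \<open>(p,q)\<close> are \<open>(ceil (p n / q), n)\<close>; their coordinates along the two
    edges are \<open>frac (- (p n / q))\<close> and \<open>n / q\<close>.\<close>
  have cone: "(\<Sum>n<q. bern_gf (frac (- (real (p * n) / real q))) x * bern_gf (real n / real q) y)
          * ((fps_exp x - 1) * (fps_exp y - 1))
        = fps_const (x * y) * fps_X ^ 2
          * (\<Sum>n<q. fps_exp x ^ nat \<lceil>real (p * n) / real q\<rceil> * fps_exp z ^ n)"
    if q: "q > 0" and y: "y = real p * x + real q * z" for p q :: nat and x z y :: real
    unfolding sum_distrib_right sum_distrib_left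
  proof (intro sum.cong refl)
    fix n
    let ?r = "real (p * n) / real q"
    have "0 \<le> ?r"
      by simp
    then have "0 \<le> \<lceil>?r\<rceil>"
      by linarith
    then have "real (nat \<lceil>?r\<rceil>) = of_int \<lceil>?r\<rceil>"
      by (simp only: of_nat_nat)
    then have c: "real (nat \<lceil>?r\<rceil>) = ?r + frac (- ?r)"
      by (simp add: frac_def ceiling_def)
    have "frac (- ?r) * x + real n / real q * y = real (nat \<lceil>?r\<rceil>) * x + real n * z"
      unfolding c using q by (simp add: y field_simps)
    then have e: "fps_exp (frac (- ?r) * x) * fps_exp (real n / real q * y)
                = fps_exp x ^ nat \<lceil>?r\<rceil> * fps_exp z ^ n"
      by (simp only: fps_exp_power_mult flip: fps_exp_add_mult)
    have "bern_gf (frac (- ?r)) x * bern_gf (real n / real q) y * ((fps_exp x - 1) * (fps_exp y - 1))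
        = (bern_gf (frac (- ?r)) x * (fps_exp x - 1)) * (bern_gf (real n / real q) y * (fps_exp y - 1))"
      by (simp only: mult_ac)
    also have "\<dots> = fps_const x * fps_const y * fps_X ^ 2
                   * (fps_exp (frac (- ?r) * x) * fps_exp (real n / real q * y))"
      unfolding bern_gf_mult_exp by (simp only: mult_ac power2_eq_square)
    finally show "bern_gf (frac (- ?r)) x * bern_gf (real n / real q) y
          * ((fps_exp x - 1) * (fps_exp y - 1))
        = fps_const (x * y) * fps_X ^ 2 * (fps_exp x ^ nat \<lceil>?r\<rceil> * fps_exp z ^ n)"
      unfolding e by (simp only: fps_const_mult)
  qed
  define X Z W where "X = fps_exp x" and "Z = fps_exp z" and "W = fps_exp y"
  define G1 where "G1 = (\<Sum>n<q. bern_gf (frac (- (real (p * n) / real q))) x * bern_gf (real n / real q) y)"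
  define G2 where "G2 = (\<Sum>m<p. bern_gf (frac (- (real (q * m) / real p))) z * bern_gf (real m / real p) y)"
  define S1 where "S1 = (\<Sum>n<q. X ^ nat \<lceil>real (p * n) / real q\<rceil> * Z ^ n)"
  define S2 where "S2 = (\<Sum>m<p. Z ^ nat \<lceil>real (q * m) / real p\<rceil> * X ^ m)"
  define cx cz cy where "cx = fps_const x" and "cz = fps_const z" and "cy = fps_const y"
  have G1: "G1 * ((X - 1) * (W - 1)) = cx * cy * fps_X ^ 2 * S1"
    unfolding G1_def S1_def X_def W_def Z_def cx_def cy_def fps_const_mult
    by (rule cone[OF q]) (simp add: y_def)
  have G2: "G2 * ((Z - 1) * (W - 1)) = cz * cy * fps_X ^ 2 * S2"
    unfolding G2_def S2_def X_def W_def Z_def cz_def cy_def fps_const_mult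
    by (rule cone[OF p]) (simp add: y_def)
  have S: "(1 - Z) * S1 + (1 - X) * S2 = 1 - W + (1 - X) * (1 - Z)"
  proof -
    have "X ^ p * Z ^ q = W"
      by (simp add: X_def Z_def W_def y_def fps_exp_power_mult flip: fps_exp_add_mult)
    then show ?thesis
      unfolding S1_def S2_def using lattice_cone_identity[OF p q cop, of Z X] by simp
  qed
  have b: "bern_gf 0 x * (X - 1) = cx * fps_X" "bern_gf 0 z * (Z - 1) = cz * fps_X"
     "bern_gf 0 y * (W - 1) = cy * fps_X"
    by (simp_all add: bern_gf_mult_exp X_def Z_def W_def cx_def cy_def cz_def)
  have "(cz * G1 + cx * G2) * ((X - 1) * (Z - 1) * (W - 1))
      = cz * (Z - 1) * (G1 * ((X - 1) * (W - 1))) + cx * (X - 1) * (G2 * ((Z - 1) * (W - 1)))"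
    by (simp only: distrib_right) (simp only: mult_ac)
  also have "\<dots> = - (cx * cy * cz * fps_X ^ 2 * ((1 - Z) * S1 + (1 - X) * S2))"
    unfolding G1 G2 by (simp add: algebra_simps)
  also have "\<dots> = cy * ((cx * fps_X) * (cz * fps_X)) * (W - 1)
               - cx * cz * fps_X * (cy * fps_X) * ((X - 1) * (Z - 1))"
    unfolding S by (simp add: algebra_simps power2_eq_square)
  also have "\<dots> = (cy * (bern_gf 0 x * bern_gf 0 z) - cx * cz * fps_X * bern_gf 0 y)
               * ((X - 1) * (Z - 1) * (W - 1))"
    unfolding b[symmetric] left_diff_distrib[of "cy * (bern_gf 0 x * bern_gf 0 z)"] by (simp only: mult_ac)
  finally have "(cz * G1 + cx * G2) * ((X - 1) * (Z - 1) * (W - 1))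
      = (cy * (bern_gf 0 x * bern_gf 0 z) - cx * cz * fps_X * bern_gf 0 y)
               * ((X - 1) * (Z - 1) * (W - 1))" .
  moreover have "y \<noteq> 0"
    using p q x z unfolding y_def by (smt (verit) mult_pos_pos of_nat_0_less_iff)
  then have "(X - 1) * (Z - 1) * (W - 1) \<noteq> 0"
    unfolding X_def Z_def W_def using x z by (simp add: fps_exp_minus_1_nonzero del: right_minus_eq)
  ultimately have "cz * G1 + cx * G2 = cy * (bern_gf 0 x * bern_gf 0 z) - cx * cz * fps_X * bern_gf 0 y"
    by simp
  then show ?thesis
    by (simp only: G1_def G2_def cx_def cy_def cz_def fps_const_mult)
qed

text \<open>The variables \<open>x\<close> and \<open>y\<close> belong to the rays
  \<open>(1,0)\<close> and \<open>(p,q)\<close>. The sign \<open>(-1) ^ i\<close> comes from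
  reflecting the edge coordinate \<open>frac (- (p n / q))\<close> to
  \<open>frac (p n / q)\<close>.\<close>

definition dedekind_form :: "nat \<Rightarrow> nat \<Rightarrow> nat \<Rightarrow> real \<Rightarrow> real \<Rightarrow> real" where
  "dedekind_form N p q x y =
     (\<Sum>i\<le>N. real (N choose i) * ((-1) ^ i * gen_dedekind_sum (N - i) i p q) * x ^ i * y ^ (N - i))"

lemma of_nat_divide_in_Ints_iff:
  assumes "q > 0"
  shows "real a / real q \<in> \<int> \<longleftrightarrow> q dvd a"
proof
  assume "real a / real q \<in> \<int>"
  then obtain k where "real a / real q = of_int k"
    by (elim Ints_cases)
  then have "real_of_int (int a) = real_of_int (int q * k)"
    using assms by (simp add: field_simps)
  then have "int a = int q * k"
    by (simp only: of_int_eq_iff)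
  then show "q dvd a"
    by (metis dvd_triv_left int_dvd_int_iff)
next
  assume "q dvd a"
  then show "real a / real q \<in> \<int>"
    using assms by (auto elim!: dvdE)
qed

text \<open>
  The sums over the half-open parallelepipeds use \<open>B\<^sub>1(0) = -1/2\<close> instead of the convention
  that \<open>periodic_bernoulli 1\<close> vanishes at integers; the discrepancy is visible only for \<open>i = j = 1\<close>.
\<close>

lemma bernoulli_poly_prod_eq_periodic:
  assumes "n < q" "coprime p q" "even (i + j)" "i + j \<ge> 2"
  shows "bernoulli_poly i (frac (- (real (p * n) / real q))) * bernoulli_poly j (real n / real q)
       = (-1) ^ i * (periodic_bernoulli j (real n / real q)
                      * periodic_bernoulli i (real (p * n) / real q))
         + (if n = 0 then if i = 1 \<and> j = 1 then 1 / 4 else 0 else 0)"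
\<comment> \<open>At \<open>n = 0\<close> both arguments are 0. If one index is 1, the other is odd,
  and its Bernoulli number vanishes unless it is 1 as well; then the product is
  \<open>(-1/2)^2 = 1/4\<close>.\<close>
proof (cases "n = 0")
  case True
  have "(of_rat (bernoulli_num 1) :: real) = - 1 / 2"
    by (simp only: bernoulli_num_1) (simp add: of_rat_divide of_rat_minus)
  then show ?thesis
    using True assms bernoulli_num_odd[of i] bernoulli_num_odd[of j]
    by (cases "odd i"; cases "i = 1"; cases "j = 1")
       (auto simp: periodic_bernoulli_def bernoulli_poly_0)
next
  case False
  have "\<not> q dvd n"
    using False assms by (meson nat_dvd_not_less neq0_conv)
  moreover have "\<not> q dvd p * n"
    using calculation assms by (metis coprime_commute coprime_dvd_mult_right_iff)
  ultimately have "real n / real q \<notin> \<int>" "real (p * n) / real q \<notin> \<int>"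
    using assms by (simp_all add: of_nat_divide_in_Ints_iff del: of_nat_mult)
  moreover have "frac (real n / real q) = real n / real q"
    using assms by (simp add: frac_eq)
  ultimately show ?thesis
    using False by (simp add: periodic_bernoulli_def frac_neg bernoulli_poly_reflect del: of_nat_mult)
qed

text \<open>The correction is \<open>2 * (1/4) * x * y\<close>, the contribution of
  \<open>n = 0\<close> to the middle term for \<open>N = 2\<close>.\<close>

lemma dedekind_form_eq_bern_gf:
  assumes q: "q > 0" and cop: "coprime p q" and N: "even N" "N \<ge> 2"
  shows "fact N * fps_nth (\<Sum>n<q. bern_gf (frac (- (real (p * n) / real q))) x
                                   * bern_gf (real n / real q) y) N
         = dedekind_form N p q x y + (if N = 2 then x * y / 2 else 0)"
proof -
  let ?P = "\<lambda>i n. bernoulli_poly i (frac (- (real (p * n) / real q))) * bernoulli_poly (N - i) (real n / real q)"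
  have P: "(\<Sum>n<q. ?P i n) = (-1) ^ i * gen_dedekind_sum (N - i) i p q
             + (if i = 1 then if N = 2 then 1 / 4 else 0 else 0)" if "i \<le> N" for i
  proof -
    have "(\<Sum>n<q. ?P i n) = (\<Sum>n<q. (-1) ^ i * (periodic_bernoulli (N - i) (real n / real q)
                      * periodic_bernoulli i (real (p * n) / real q))
         + (if n = 0 then if i = 1 \<and> N - i = 1 then 1 / 4 else 0 else 0))"
      using that N by (intro sum.cong refl bernoulli_poly_prod_eq_periodic cop) auto
    also have "\<dots> = (-1) ^ i * gen_dedekind_sum (N - i) i p q + (if i = 1 \<and> N - i = 1 then 1 / 4 else 0)"
      using q by (simp add: sum.distrib gen_dedekind_sum_def atLeast0LessThan sum_distrib_left)
    finally show ?thesis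
      using that by auto
  qed
  have "fact N * fps_nth (\<Sum>n<q. bern_gf (frac (- (real (p * n) / real q))) x
                                   * bern_gf (real n / real q) y) N
      = (\<Sum>n<q. \<Sum>i\<le>N. real (N choose i) * ?P i n * x ^ i * y ^ (N - i))"
    by (simp only: fps_sum_nth sum_distrib_left bern_gf_mult_nth)
  also have "\<dots> = (\<Sum>i\<le>N. real (N choose i) * (\<Sum>n<q. ?P i n) * x ^ i * y ^ (N - i))"
    by (subst sum.swap) (simp only: sum_distrib_left sum_distrib_right)
  also have "\<dots> = (\<Sum>i\<le>N. real (N choose i) * ((-1) ^ i * gen_dedekind_sum (N - i) i p q) * x ^ i * y ^ (N - i)
           + (if i = 1 then if N = 2 then x * y / 2 else 0 else 0))"
  proof (intro sum.cong refl)
    fix i assume "i \<in> {..N}"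
    then have "i \<le> N"
      by simp
    show "real (N choose i) * (\<Sum>n<q. ?P i n) * x ^ i * y ^ (N - i)
        = real (N choose i) * ((-1) ^ i * gen_dedekind_sum (N - i) i p q) * x ^ i * y ^ (N - i)
           + (if i = 1 then if N = 2 then x * y / 2 else 0 else 0)"
      unfolding P[OF \<open>i \<le> N\<close>] by (auto simp: algebra_simps)
  qed
  also have "\<dots> = dedekind_form N p q x y + (if N = 2 then x * y / 2 else 0)"
    using N by (simp add: sum.distrib dedekind_form_def)
  finally show ?thesis .
qed

text \<open>This is the part of degree \<open>N\<close> of \<open>bern_gf_reciprocity\<close>. The
  last term there contains \<open>B_(N-1)\<close>, which vanishes for \<open>N > 2\<close>; for
  \<open>N = 2\<close> it contributes \<open>x y z\<close> and cancels the corrections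
  \<open>x y / 2\<close> and \<open>z y / 2\<close> of the two forms.\<close>

lemma dedekind_form_reciprocity:
  fixes x z :: real
  assumes p: "p > 0" and q: "q > 0" and cop: "coprime p q" and x: "x > 0" and z: "z > 0"
    and N: "even N" "N \<ge> 2"
  defines "y \<equiv> real p * x + real q * z"
  shows "z * dedekind_form N p q x y + x * dedekind_form N q p z y
       = y * (\<Sum>i\<le>N. real (N choose i) * (of_rat (bernoulli_num i) * of_rat (bernoulli_num (N - i)))
                      * x ^ i * z ^ (N - i))"
proof -
  have cop': "coprime q p"
    using cop by (simp add: coprime_commute)
  define G1 where "G1 = (\<Sum>n<q. bern_gf (frac (- (real (p * n) / real q))) x * bern_gf (real n / real q) y)"
  define G2 where "G2 = (\<Sum>m<p. bern_gf (frac (- (real (q * m) / real p))) z * bern_gf (real m / real p) y)"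
  have "fps_const z * G1 + fps_const x * G2
      = fps_const y * (bern_gf 0 x * bern_gf 0 z) - fps_const (x * z) * (fps_X * bern_gf 0 y)"
    using bern_gf_reciprocity[OF p q cop x z]
    unfolding G1_def G2_def y_def by (simp only: mult.assoc)
  from arg_cong[OF this, of "\<lambda>f. fact N * fps_nth f N"]
  have "z * (fact N * fps_nth G1 N) + x * (fact N * fps_nth G2 N)
      = y * (fact N * fps_nth (bern_gf 0 x * bern_gf 0 z) N)
        - x * z * (fact N * fps_nth (fps_X * bern_gf 0 y) N)"
    by (simp only: fps_add_nth fps_sub_nth fps_mult_left_const_nth distrib_left right_diff_distrib)
       (simp only: mult_ac)
  moreover have "fact N * fps_nth (fps_X * bern_gf 0 y) N = (if N = 2 then - y else 0)"
  proof (cases "N = 2")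
    case True
    have "(of_rat (bernoulli_num 1) :: real) = - 1 / 2"
      by (simp only: bernoulli_num_1) (simp add: of_rat_divide of_rat_minus)
    then show ?thesis
      using True by (simp add: bern_gf_def bernoulli_poly_0)
  next
    case False
    then have "bernoulli_num (N - 1) = 0"
      using N by (intro bernoulli_num_odd) auto
    then show ?thesis
      using False by (simp add: bern_gf_def bernoulli_poly_0)
  qed
  ultimately show ?thesis
    unfolding G1_def G2_def dedekind_form_eq_bern_gf[OF q cop N] dedekind_form_eq_bern_gf[OF p cop' N]
      bern_gf_mult_nth bernoulli_poly_0
    by (simp add: algebra_simps split: if_splits)
qed

subsection \<open>Integrality up to polar terms\<close>

text \<open>Binary forms with integer coefficients are represented by real functions, so that a
  change of lattice basis is mere composition.\<close>

definition int_form :: "nat \<Rightarrow> (real \<Rightarrow> real \<Rightarrow> real) \<Rightarrow> bool" where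
  "int_form n f \<longleftrightarrow> (\<exists>c :: nat \<Rightarrow> int. \<forall>x z. f x z = (\<Sum>k\<le>n. of_int (c k) * x ^ k * z ^ (n - k)))"

lemma int_formI:
  assumes "\<And>k. k \<le> n \<Longrightarrow> c k \<in> \<int>" "\<And>x z. f x z = (\<Sum>k\<le>n. c k * x ^ k * z ^ (n - k))"
  shows "int_form n f"
proof -
  have "\<exists>m. c k = of_int m" if "k \<le> n" for k
    using assms(1)[OF that] by (auto elim: Ints_cases)
  then obtain d :: "nat \<Rightarrow> int" where d: "\<And>k. k \<le> n \<Longrightarrow> c k = of_int (d k)"
    by metis
  show ?thesis
    unfolding int_form_def assms(2) by (intro exI[of _ d]) (simp add: d)
qed

lemma int_form_monom:
  assumes "k + l = n"
  shows "int_form n (\<lambda>x z. of_int c * x ^ k * z ^ l)"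
proof (rule int_formI)
  fix x z :: real
  have "(\<Sum>i\<le>n. (if i = k then of_int c else 0) * x ^ i * z ^ (n - i))
      = (\<Sum>i\<le>n. if i = k then of_int c * x ^ i * z ^ (n - i) else 0)"
    by (intro sum.cong) auto
  also have "\<dots> = of_int c * x ^ k * z ^ l"
    using assms by auto
  finally show "of_int c * x ^ k * z ^ l = (\<Sum>i\<le>n. (if i = k then of_int c else 0) * x ^ i * z ^ (n - i))" ..
qed auto

lemma int_form_add:
  assumes "int_form n f" "int_form n g"
  shows "int_form n (\<lambda>x z. f x z + g x z)"
proof -
  obtain c d where "\<And>x z. f x z = (\<Sum>k\<le>n. of_int (c k) * x ^ k * z ^ (n - k))"
    "\<And>x z. g x z = (\<Sum>k\<le>n. of_int (d k) * x ^ k * z ^ (n - k))"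
    using assms unfolding int_form_def by metis
  then show ?thesis
    by (intro int_formI[of _ "\<lambda>k. of_int (c k) + of_int (d k)"])
       (auto simp: algebra_simps sum.distrib)
qed

lemma int_form_sum:
  assumes "\<And>a. a \<in> A \<Longrightarrow> int_form n (f a)"
  shows "int_form n (\<lambda>x z. \<Sum>a\<in>A. f a x z)"
proof (cases "finite A")
  case True
  then show ?thesis
    using assms
  proof (induction A rule: finite_induct)
    case empty
    show ?case
      by (rule int_formI[of _ "\<lambda>_. 0"]) auto
  next
    case (insert a A)
    then show ?case
      by (simp add: int_form_add)
  qed
next
  case False
  then show ?thesis
    by (intro int_formI[of _ "\<lambda>_. 0"]) auto
qed

lemma int_form_mult:
  assumes "int_form m f" "int_form n g"
  shows "int_form (m + n) (\<lambda>x z. f x z * g x z)"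
proof -
  obtain c d where f: "\<And>x z. f x z = (\<Sum>k\<le>m. of_int (c k) * x ^ k * z ^ (m - k))"
    and g: "\<And>x z. g x z = (\<Sum>k\<le>n. of_int (d k) * x ^ k * z ^ (n - k))"
    using assms unfolding int_form_def by metis
  have "(\<lambda>x z. f x z * g x z) = (\<lambda>x z. \<Sum>k\<le>m. \<Sum>l\<le>n.
      of_int (c k * d l) * x ^ (k + l) * z ^ ((m - k) + (n - l)))"
    unfolding f g sum_product of_int_mult power_add by (simp only: mult_ac)
  moreover have "int_form (m + n) (\<lambda>x z. \<Sum>k\<le>m. \<Sum>l\<le>n.
      of_int (c k * d l) * x ^ (k + l) * z ^ ((m - k) + (n - l)))"
    by (intro int_form_sum int_form_monom) auto
  ultimately show ?thesis
    by simp
qed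

lemma int_form_const: "int_form 0 (\<lambda>x z. of_int c)"
  using int_form_monom[of 0 0 0 c] by simp

lemma int_form_cmult: "int_form n f \<Longrightarrow> int_form n (\<lambda>x z. of_int c * f x z)"
  using int_form_mult[OF int_form_const] by simp

lemma int_form_diff:
  assumes "int_form n f" "int_form n g"
  shows "int_form n (\<lambda>x z. f x z - g x z)"
  using int_form_add[OF assms(1) int_form_cmult[OF assms(2), of "-1"]] by simp

lemma int_form_power: "int_form 1 f \<Longrightarrow> int_form n (\<lambda>x z. f x z ^ n)"
proof (induction n)
  case 0
  show ?case
    using int_form_const[of 1] by simp
next
  case (Suc n)
  then show ?case
    using int_form_mult[of 1 f n "\<lambda>x z. f x z ^ n"] by simp
qed

lemma int_form_linear: "int_form 1 (\<lambda>x z. of_int a * x + of_int b * z)"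
  using int_form_add[OF int_form_monom[of 1 0 1 a] int_form_monom[of 0 1 1 b]] by simp

text \<open>Serves the changes of lattice coordinates: each monomial becomes a product of powers of
  integral linear forms.\<close>

lemma int_form_compose:
  assumes f: "int_form n f" and g: "int_form 1 g" and h: "int_form 1 h"
  shows "int_form n (\<lambda>x z. f (g x z) (h x z))"
proof -
  obtain c where f: "\<And>x z. f x z = (\<Sum>k\<le>n. of_int (c k) * x ^ k * z ^ (n - k))"
    using f unfolding int_form_def by metis
  have "int_form n (\<lambda>x z. of_int (c k) * (g x z ^ k * h x z ^ (n - k)))" if "k \<le> n" for k
    using int_form_cmult[OF int_form_mult[OF int_form_power[OF g, of k] int_form_power[OF h, of "n - k"]]]
      that by simp
  then show ?thesis
    unfolding f mult.assoc by (intro int_form_sum) auto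
qed

section \<open>Splitting off the polar terms of the Bernoulli form\<close>

lemma sum_split_ends:
  fixes c :: "nat \<Rightarrow> real"
  assumes "N \<ge> 2"
  shows "(\<Sum>i\<le>N. c i * x ^ i * z ^ (N - i))
       = c 0 * z ^ N + c N * x ^ N + x * z * (\<Sum>k\<le>N-2. c (Suc k) * x ^ k * z ^ (N - 2 - k))"
proof -
  obtain M where M: "N = Suc (Suc M)"
    using assms by (metis Suc_le_D numeral_2_eq_2 Suc_le_mono)
  have "(\<Sum>k\<le>M. c (Suc k) * x ^ Suc k * z ^ (Suc M - k))
      = x * z * (\<Sum>k\<le>M. c (Suc k) * x ^ k * z ^ (M - k))"
    unfolding sum_distrib_left by (intro sum.cong refl) (auto simp: Suc_diff_le)
  then show ?thesis
    unfolding M by (subst sum.atMost_Suc_shift) simp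
qed

lemma bern_denom_mult: "of_int (bern_denom N) * bernoulli_num N = of_int (bern_numer N)"
proof -
  obtain a b where ab: "quotient_of (bernoulli_num N) = (a, b)"
    by force
  then have "b > 0"
    by (rule quotient_of_denom_pos)
  then show ?thesis
    using quotient_of_div[OF ab] ab by (simp add: bern_denom_def bern_numer_def)
qed

lemma bern_denom_2: "bern_denom 2 = 6"
proof -
  have "bernoulli_num 2 = Fract 1 6"
    by (simp add: bernoulli_num_2 Fract_of_int_quotient)
  then show ?thesis
    by (simp add: bern_denom_def quotient_of_Fract Rat.normalize_def Let_def)
qed

text \<open>For even \<open>i\<close> the denominator divides \<open>bern_lcm N\<close>, where it is
  listed under the index \<open>i - 1\<close>. For odd \<open>i\<close> one of the two Bernoulli
  numbers vanishes, except for \<open>i = 1\<close> and \<open>N = 2\<close>, where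
  \<open>t = 6 * 2 * (1/4) = 3\<close>.\<close>

lemma bern_lcm_mult_in_Ints:
  assumes N: "even N" and i: "0 < i" "i < N"
  shows "of_int (bern_denom N * bern_lcm N)
           * (real (N choose i) * (of_rat (bernoulli_num i) * of_rat (bernoulli_num (N - i)))) \<in> \<int>"
proof -
  define t where "t = of_int (bern_denom N) * of_nat (N choose i) * bernoulli_num i * bernoulli_num (N - i)"
  have "of_int (bern_lcm N) * t \<in> \<int>"
  proof (cases "even i")
    case True
    obtain a b where ab: "quotient_of t = (a, b)"
      by force
    have "b > 0"
      using ab by (rule quotient_of_denom_pos)
    have "snd (quotient_of t) \<in> {snd (quotient_of (of_int (bern_denom N) * of_nat (N choose (i + 1)) *
                            bernoulli_num (i + 1) * bernoulli_num (N - i - 1)))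
          | i. odd i \<and> i + 2 \<le> N}"
      unfolding mem_Collect_eq t_def using i True N by (intro exI[of _ "i - 1"]) (auto elim!: evenE)
    then have "snd (quotient_of t) dvd bern_lcm N"
      unfolding bern_lcm_def by (rule dvd_Lcm)
    then have "b dvd bern_lcm N"
      using ab by simp
    then obtain k where "bern_lcm N = b * k" ..
    then have "of_int (bern_lcm N) * t = of_int (k * a)"
      using quotient_of_div[OF ab] \<open>b > 0\<close> by simp
    then show ?thesis
      by (metis Ints_of_int)
  next
    case odd: False
    show ?thesis
    proof (cases "i = 1 \<and> N = 2")
      case True
      have "t = of_int 3"
        using True bernoulli_num_1 by (simp add: t_def bern_denom_2)
      then show ?thesis
        by (metis Ints_of_int of_int_mult)
    next
      case False
      then have "i \<noteq> 1 \<or> N - i \<noteq> 1"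
        using i by linarith
      then have "bernoulli_num i = 0 \<or> bernoulli_num (N - i) = 0"
        using bernoulli_num_odd[of i] bernoulli_num_odd[of "N - i"] odd N i by auto
      then show ?thesis
        by (auto simp: t_def)
    qed
  qed
  then obtain m where "of_int (bern_lcm N) * t = of_int m"
    by (elim Ints_cases)
  then have "(of_rat (of_int (bern_lcm N) * t) :: real) = of_int m"
    by simp
  then have "of_int (bern_denom N * bern_lcm N)
           * (real (N choose i) * (of_rat (bernoulli_num i) * of_rat (bernoulli_num (N - i)))) = of_int m"
    by (simp add: t_def of_rat_mult mult_ac)
  then show ?thesis
    by (simp only: Ints_of_int)
qed

text \<open>The two end terms contain \<open>B_0 = 1\<close> and yield \<alpha> times the lcm; all
  other terms are divisible by \<open>x z\<close> and integral by
  \<open>bern_lcm_mult_in_Ints\<close>.\<close>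

lemma bernoulli_form_decomposition:
  assumes N: "even N" "N \<ge> 2"
  obtains Q where "int_form (N - 2) Q"
    "\<And>x z. of_int (bern_denom N * bern_lcm N)
         * (\<Sum>i\<le>N. real (N choose i) * (of_rat (bernoulli_num i) * of_rat (bernoulli_num (N - i)))
                     * x ^ i * z ^ (N - i))
       = x * z * Q x z + of_int (bern_numer N * bern_lcm N) * (x ^ N + z ^ N)"
proof -
  let ?c = "\<lambda>i. of_int (bern_denom N * bern_lcm N)
         * (real (N choose i) * (of_rat (bernoulli_num i) * of_rat (bernoulli_num (N - i))))"
  let ?Q = "\<lambda>x z. \<Sum>k\<le>N-2. ?c (Suc k) * x ^ k * z ^ (N - 2 - k)"
  have "of_int (bern_denom N) * of_rat (bernoulli_num N) = real_of_int (bern_numer N)"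
    using arg_cong[OF bern_denom_mult[of N], of "of_rat :: rat \<Rightarrow> real"] by (simp add: of_rat_mult)
  then have ends: "?c 0 = of_int (bern_numer N * bern_lcm N)" "?c N = of_int (bern_numer N * bern_lcm N)"
    by (simp_all add: bernoulli_num_0 mult_ac)
  have "int_form (N - 2) ?Q"
    using N by (intro int_formI[of _ "\<lambda>k. ?c (Suc k)"] bern_lcm_mult_in_Ints refl) auto
  moreover have "of_int (bern_denom N * bern_lcm N)
         * (\<Sum>i\<le>N. real (N choose i) * (of_rat (bernoulli_num i) * of_rat (bernoulli_num (N - i)))
                     * x ^ i * z ^ (N - i))
       = x * z * ?Q x z + of_int (bern_numer N * bern_lcm N) * (x ^ N + z ^ N)" for x z
  proof -
    have "of_int (bern_denom N * bern_lcm N)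
         * (\<Sum>i\<le>N. real (N choose i) * (of_rat (bernoulli_num i) * of_rat (bernoulli_num (N - i)))
                     * x ^ i * z ^ (N - i)) = (\<Sum>i\<le>N. ?c i * x ^ i * z ^ (N - i))"
      by (simp only: sum_distrib_left mult.assoc)
    also have "\<dots> = ?c 0 * z ^ N + ?c N * x ^ N + x * z * ?Q x z"
      by (rule sum_split_ends[OF N(2)])
    finally show ?thesis
      unfolding ends by (simp only: distrib_left add_ac)
  qed
  ultimately show ?thesis
    by (rule that)
qed

section \<open>Descent along the Euclidean algorithm\<close>

text \<open>
  For \<open>x, z > 0\<close> let \<open>y = p x + q z\<close> and \<open>w = a x + b z\<close> be the values of a linear functional at
  the ray generators \<open>(p, q)\<close> and \<open>(a, b)\<close>.  After division by \<open>x y\<close> the only non-integral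
  contributions are the polar terms \<open>z ^ (N - 1) / x\<close> and \<open>w ^ (N - 1) / y\<close> at the two boundary rays.
\<close>

definition dedekind_decomp :: "nat \<Rightarrow> nat \<Rightarrow> nat \<Rightarrow> bool" where
  "dedekind_decomp N p q \<longleftrightarrow>
     (\<exists>Q a b. int_form (N - 2) Q \<and> a * int q - b * int p = 1 \<and>
       (\<forall>x > 0. \<forall>z > 0.
          of_int (bern_denom N * bern_lcm N) * dedekind_form N p q x (real p * x + real q * z)
          = x * (real p * x + real q * z) * Q x z
            + of_int (bern_numer N * bern_lcm N)
              * (z ^ (N - 1) * (real p * x + real q * z) + x * (of_int a * x + of_int b * z) ^ (N - 1))))"

text \<open>The cone is the whole quadrant, with \<open>y = z\<close> and
  \<open>(a,b) = (1,0)\<close>. Its form is the Bernoulli form, up to the middle term for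
  \<open>N = 2\<close>.\<close>

lemma dedekind_decomp_0_1:
  assumes N: "even N" "N \<ge> 2"
  shows "dedekind_decomp N 0 1"
proof -
  obtain Q where Q: "int_form (N - 2) Q"
    "\<And>x z. of_int (bern_denom N * bern_lcm N)
         * (\<Sum>i\<le>N. real (N choose i) * (of_rat (bernoulli_num i) * of_rat (bernoulli_num (N - i)))
                     * x ^ i * z ^ (N - i))
       = x * z * Q x z + of_int (bern_numer N * bern_lcm N) * (x ^ N + z ^ N)"
    using bernoulli_form_decomposition[OF N] by blast
  let ?b = "\<lambda>i. of_rat (bernoulli_num i) :: real"
  \<comment> \<open>For \<open>N = 2\<close> the value 0 of \<open>periodic_bernoulli 1\<close> at
    integers removes the middle term \<open>x z / 2\<close>; multiplied by
    \<open>bern_denom 2 = 6\<close> and the lcm this gives \<open>e\<close>. For larger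
    \<open>N\<close> the terms with odd \<open>i\<close> vanish on both sides, so the sign
    \<open>(-1) ^ i\<close> is harmless.\<close>
  obtain e :: int where e: "\<And>x z. of_int (bern_denom N * bern_lcm N) * dedekind_form N 0 1 x z =
     of_int (bern_denom N * bern_lcm N) * (\<Sum>i\<le>N. real (N choose i) * (?b i * ?b (N - i)) * x ^ i * z ^ (N - i))
      - of_int e * x * z" and e0: "N \<noteq> 2 \<Longrightarrow> e = 0"
  proof (cases "N = 2")
    case True
    have b1: "?b (Suc 0) = - 1 / 2"
      using bernoulli_num_1 by (simp add: of_rat_divide of_rat_minus)
    show ?thesis
      using True by (intro that[of "3 * bern_lcm N"])
        (simp_all add: dedekind_form_def gen_dedekind_sum_def periodic_bernoulli_def eval_nat_numeral b1 bern_denom_2[unfolded numeral_2_eq_2] field_simps)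
  next
    case False
    have "(-1) ^ i * gen_dedekind_sum (N - i) i 0 1 = ?b i * ?b (N - i)" if "i \<le> N" for i
      using False N that even_diff_nat[of N i] bernoulli_num_odd[of i] bernoulli_num_odd[of "N - i"]
      by (cases "even i"; cases "i = 1"; cases "N - i = 1")
         (auto simp: gen_dedekind_sum_def periodic_bernoulli_def)
    then show ?thesis
      by (intro that[of 0]) (simp_all add: dedekind_form_def)
  qed
  have "int_form (N - 2) (\<lambda>x z. Q x z - of_int e)"
  proof (cases "N = 2")
    case True
    then show ?thesis
      using int_form_diff[OF Q(1), of "\<lambda>_ _. of_int e"] int_form_const[of e] by simp
  next
    case False
    then show ?thesis
      using e0 Q(1) by simp
  qed
  moreover have "of_int (bern_denom N * bern_lcm N) * dedekind_form N 0 1 x (real 0 * x + real 1 * z)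
          = x * (real 0 * x + real 1 * z) * (Q x z - of_int e)
            + of_int (bern_numer N * bern_lcm N)
              * (z ^ (N - 1) * (real 0 * x + real 1 * z) + x * (of_int 1 * x + of_int 0 * z) ^ (N - 1))" for x z
  proof -
    have pw: "u ^ N = u * u ^ (N - 1)" for u :: real
      using N by (simp add: power_eq_if)
    show ?thesis
      using e[of x z] unfolding Q(2) pw by (simp add: algebra_simps)
  qed
  ultimately show ?thesis
    unfolding dedekind_decomp_def by (intro exI[of _ "\<lambda>x z. Q x z - of_int e"] exI[of _ 1] exI[of _ 0]) auto
qed

lemma gen_dedekind_sum_add:
  assumes "q > 0"
  shows "gen_dedekind_sum i j (p + q) q = gen_dedekind_sum i j p q"
proof -
  have "periodic_bernoulli j (real ((p + q) * k) / real q) = periodic_bernoulli j (real (p * k) / real q)" for k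
  proof -
    have "real ((p + q) * k) / real q = real (p * k) / real q + of_int (int k)"
      using assms by (simp add: field_simps)
    then show ?thesis
      by (simp only: periodic_bernoulli_def) (simp add: frac_def)
  qed
  then show ?thesis
    by (simp only: gen_dedekind_sum_def)
qed

text \<open>The form depends only on \<open>p\<close> modulo \<open>q\<close>, and replacing
  \<open>z\<close> by \<open>x + z\<close> carries \<open>y\<close> and \<open>w\<close> over to
  those of the new cone. Only the polar term at the first ray changes, from
  \<open>(x + z) ^ (N - 1)\<close> to \<open>z ^ (N - 1)\<close>; the difference is \<open>x\<close>
  times the integral form \<open>S\<close>.\<close>

lemma dedekind_decomp_add:
  assumes q: "q > 0" and N: "N \<ge> 2" and D: "dedekind_decomp N p q"
  shows "dedekind_decomp N (p + q) q"
proof -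
  let ?A = "real_of_int (bern_numer N * bern_lcm N)" and ?K = "real_of_int (bern_denom N * bern_lcm N)"
  obtain Q a b where Q: "int_form (N - 2) Q" and ab: "a * int q - b * int p = 1"
    and eq: "\<And>x z. x > 0 \<Longrightarrow> z > 0 \<Longrightarrow>
          ?K * dedekind_form N p q x (real p * x + real q * z)
          = x * (real p * x + real q * z) * Q x z
            + ?A * (z ^ (N - 1) * (real p * x + real q * z) + x * (of_int a * x + of_int b * z) ^ (N - 1))"
    using D unfolding dedekind_decomp_def by blast
  define S :: "real \<Rightarrow> real \<Rightarrow> real" where "S = (\<lambda>x z. \<Sum>k<N-1. z ^ (N - 1 - Suc k) * (x + z) ^ k)"
  have S: "(x + z) ^ (N - 1) = z ^ (N - 1) + x * S x z" for x z
    using power_diff_sumr2[of "x + z" "N - 1" z] by (simp add: S_def)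
  have lin: "int_form 1 (\<lambda>x z. x)" "int_form 1 (\<lambda>x z. z)" "int_form 1 (\<lambda>x z. x + z)"
    using int_form_linear[of 1 0] int_form_linear[of 0 1] int_form_linear[of 1 1] by simp_all
  have "int_form (N - 2) S"
    unfolding S_def
  proof (rule int_form_sum)
    fix k assume "k \<in> {..<N-1}"
    then have "N - 1 - Suc k + k = N - 2"
      by auto
    then show "int_form (N - 2) (\<lambda>x z. z ^ (N - 1 - Suc k) * (x + z) ^ k)"
      using int_form_mult[OF int_form_power[OF lin(2), of "N - 1 - Suc k"] int_form_power[OF lin(3), of k]]
      by simp
  qed
  then have "int_form (N - 2) (\<lambda>x z. Q x (x + z) + of_int (bern_numer N * bern_lcm N) * S x z)"
    by (intro int_form_add int_form_cmult int_form_compose[OF Q] lin)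
  moreover have "(a + b) * int q - b * int (p + q) = 1"
    using ab by (simp add: algebra_simps)
  moreover have "?K * dedekind_form N (p + q) q x (real (p + q) * x + real q * z)
          = x * (real (p + q) * x + real q * z) * (Q x (x + z) + ?A * S x z)
            + ?A * (z ^ (N - 1) * (real (p + q) * x + real q * z) + x * (of_int (a + b) * x + of_int b * z) ^ (N - 1))"
    if "x > 0" "z > 0" for x z
  proof -
    have f: "dedekind_form N (p + q) q = dedekind_form N p q"
      using q by (intro ext) (simp add: dedekind_form_def gen_dedekind_sum_add)
    define y where "y = real (p + q) * x + real q * z"
    define w where "w = of_int (a + b) * x + of_int b * z"
    have y: "real p * x + real q * (x + z) = y" and w: "of_int a * x + of_int b * (x + z) = w"
      by (simp_all add: algebra_simps y_def w_def)
    show ?thesis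
      using eq[of x "x + z"] that unfolding f y w S y_def[symmetric] w_def[symmetric]
      by (simp add: algebra_simps)
  qed
  ultimately show ?thesis
    unfolding dedekind_decomp_def by blast
qed

text \<open>By reciprocity the decomposition for \<open>(q,p)\<close>, with \<open>x\<close> and
  \<open>z\<close> exchanged, is subtracted from that of the Bernoulli form. The polar terms
  \<open>x ^ (N - 1) / z\<close> at the common ray \<open>(0,1)\<close> cancel, and
  \<open>(a,b)\<close> becomes \<open>(-b,-a)\<close>.\<close>

lemma dedekind_decomp_swap:
  assumes p: "p > 0" and q: "q > 0" and cop: "coprime p q" and N: "even N" "N \<ge> 2"
    and D: "dedekind_decomp N q p"
  shows "dedekind_decomp N p q"
proof -
  let ?A = "real_of_int (bern_numer N * bern_lcm N)" and ?K = "real_of_int (bern_denom N * bern_lcm N)"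
  obtain Q a b where Q: "int_form (N - 2) Q" and ab: "a * int p - b * int q = 1"
    and eq: "\<And>x z. x > 0 \<Longrightarrow> z > 0 \<Longrightarrow>
          ?K * dedekind_form N q p x (real q * x + real p * z)
          = x * (real q * x + real p * z) * Q x z
            + ?A * (z ^ (N - 1) * (real q * x + real p * z) + x * (of_int a * x + of_int b * z) ^ (N - 1))"
    using D unfolding dedekind_decomp_def by blast
  let ?F = "\<lambda>x z. \<Sum>i\<le>N. real (N choose i) * (of_rat (bernoulli_num i) * of_rat (bernoulli_num (N - i)))
                     * x ^ i * z ^ (N - i)"
  obtain Q0 where Q0: "int_form (N - 2) Q0"
    "\<And>x z. ?K * ?F x z = x * z * Q0 x z + ?A * (x ^ N + z ^ N)"
    using bernoulli_form_decomposition[OF N] by blast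
  have lin: "int_form 1 (\<lambda>x z. x)" "int_form 1 (\<lambda>x z. z)"
    using int_form_linear[of 1 0] int_form_linear[of 0 1] by simp_all
  have "int_form (N - 2) (\<lambda>x z. Q0 x z - Q z x)"
    by (intro int_form_diff Q0(1) int_form_compose[OF Q] lin)
  moreover have "- b * int q - (- a) * int p = 1"
    using ab by simp
  moreover have "?K * dedekind_form N p q x (real p * x + real q * z)
          = x * (real p * x + real q * z) * (Q0 x z - Q z x)
            + ?A * (z ^ (N - 1) * (real p * x + real q * z) + x * (of_int (- b) * x + of_int (- a) * z) ^ (N - 1))"
    if x: "x > 0" and z: "z > 0" for x z
  proof -
    define y where "y = real p * x + real q * z"
    define w where "w = of_int (- b) * x + of_int (- a) * z"
    have y: "real q * z + real p * x = y" and w: "of_int a * z + of_int b * x = - w"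
      by (simp_all add: y_def w_def)
    have pw: "u ^ N = u * u ^ (N - 1)" for u :: real
      using N by (simp add: power_eq_if)
    \<comment> \<open>The new \<open>w\<close> is the negative of the old one. As
      \<open>N - 1\<close> is odd, this sign undoes the one from the subtraction, so the polar term
      at \<open>y\<close> has the required form.\<close>
    have wN: "(- w) ^ (N - 1) = - (w ^ (N - 1))"
      using N by (simp add: power_minus_odd)
    define F where "F = ?F x z"
    define D1 D2 where "D1 = dedekind_form N p q x y" and "D2 = dedekind_form N q p z y"
    have "z * D1 + x * D2 = y * F"
      using dedekind_form_reciprocity[OF p q cop x z N] unfolding D1_def D2_def F_def y_def .
    then have "z * D1 = y * F - x * D2"
      by simp
    from arg_cong[OF this, of "\<lambda>t. ?K * t"]
    have "z * (?K * D1) = y * (?K * F) - x * (?K * D2)"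
      by (simp only: right_diff_distrib mult_ac)
    also have "?K * D2 = z * y * Q z x + ?A * (x ^ (N - 1) * y - z * w ^ (N - 1))"
      using eq[OF z x] unfolding y w wN D2_def by simp
    also have "?K * F = x * z * Q0 x z + ?A * (x * x ^ (N - 1) + z * z ^ (N - 1))"
      unfolding F_def Q0(2) pw ..
    finally have "z * (?K * D1) = z * (x * y * (Q0 x z - Q z x) + ?A * (z ^ (N - 1) * y + x * w ^ (N - 1)))"
      by (simp add: algebra_simps)
    then show ?thesis
      using z unfolding D1_def y_def w_def by simp
  qed
  ultimately show ?thesis
    unfolding dedekind_decomp_def by blast
qed

text \<open>Subtractive Euclidean algorithm, by induction on \<open>p + q\<close>; it ends at
  \<open>p = 0\<close>, where coprimality forces \<open>q = 1\<close>.\<close>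

lemma dedekind_decomp_coprime:
  assumes N: "even N" "N \<ge> 2" and "q > 0" "coprime p q"
  shows "dedekind_decomp N p q"
  using assms(3,4)
proof (induction "p + q" arbitrary: p q rule: less_induct)
  case less
  consider "p = 0" | "p \<ge> q" | "0 < p" "p < q"
    by linarith
  then show ?case
  proof cases
    case 1
    then show ?thesis
      using less.prems dedekind_decomp_0_1[OF N] by simp
  next
    case 2
    have "coprime (p - q) q"
      using 2 less.prems by (simp add: coprime_iff_gcd_eq_1 gcd_diff1_nat)
    then have "dedekind_decomp N (p - q) q"
      using 2 less by (intro less.hyps) auto
    then show ?thesis
      using dedekind_decomp_add[of q N "p - q"] 2 less.prems N by simp
  next
    case 3
    \<comment> \<open>A swap alone leaves \<open>p + q\<close> unchanged, so it is combined with one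
      subtraction: the induction hypothesis is used for \<open>(q - p, p)\<close>, whose sum is
      \<open>q\<close>.\<close>
    have "coprime (q - p) p"
      using 3 less.prems gcd_diff1_nat[of p q] by (simp add: coprime_iff_gcd_eq_1 gcd.commute)
    then have "dedekind_decomp N (q - p) p"
      using 3 by (intro less.hyps) auto
    then have "dedekind_decomp N q p"
      using dedekind_decomp_add[of p N "q - p"] 3 N by simp
    then show ?thesis
      by (rule dedekind_decomp_swap[OF 3(1) less.prems N])
  qed
qed

section \<open>From lattice coordinates to coordinates along the two rays\<close>

lemma polyfun_eq_coeffs_on_infinite:
  fixes c d :: "nat \<Rightarrow> real"
  assumes "infinite S" "\<And>x. x \<in> S \<Longrightarrow> (\<Sum>i\<le>n. c i * x ^ i) = (\<Sum>i\<le>n. d i * x ^ i)" "k \<le> n"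
  shows "c k = d k"
proof (rule ccontr)
  assume "c k \<noteq> d k"
  then have "finite {x. (\<Sum>i\<le>n. (c i - d i) * x ^ i) = 0}"
    using polyfun_finite_roots[of "\<lambda>i. c i - d i" n] assms(3) by auto
  moreover have "S \<subseteq> {x. (\<Sum>i\<le>n. (c i - d i) * x ^ i) = 0}"
    using assms(2) by (auto simp: left_diff_distrib sum_subtractf)
  ultimately show False
    using assms(1) finite_subset by blast
qed

text \<open>With \<open>x = q t\<close> and \<open>z = 1 - p t\<close> one gets \<open>y = q\<close>
  and \<open>w = t + b\<close>, and \<open>s_ij\<close> sits in the coefficient of
  \<open>t ^ j\<close>. The form carries \<open>q ^ N\<close>, and \<open>x y Q\<close> carries
  \<open>q ^ 2\<close>; after cancelling one \<open>q\<close> the integral part is still a multiple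
  of \<open>q\<close>. The relation \<open>a q - b p = 1\<close> makes \<open>-b\<close> an inverse
  of \<open>p\<close>.\<close>

lemma dedekind_sum_eq_int_plus_polar:
  fixes i j N p q :: nat
  assumes ij: "i \<ge> 1" "j \<ge> 1" and N: "N = i + j" "even N"
    and p: "p > 0" and q: "q > 0" and cop: "coprime p q"
  obtains b m :: int where "[- b * int p = 1] (mod int q)"
    "of_int (dedekind_R i j) * real q ^ (N - 1) * gen_dedekind_sum i j p q
       = of_int (int q * m + bern_numer N * bern_lcm N
                   * (int ((N - 1) choose j) * int p ^ j + int ((N - 1) choose i) * (- b) ^ i))"
proof -
  have N2: "N \<ge> 2"
    using ij N by simp
  obtain M where M: "N = Suc (Suc M)"
    using N2 by (metis Suc_le_D numeral_2_eq_2 Suc_le_mono)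
  let ?A = "real_of_int (bern_numer N * bern_lcm N)" and ?K = "real_of_int (bern_denom N * bern_lcm N)"
  obtain Q a b where Q: "int_form (N - 2) Q" and ab: "a * int q - b * int p = 1"
    and eq: "\<And>x z. x > 0 \<Longrightarrow> z > 0 \<Longrightarrow>
          ?K * dedekind_form N p q x (real p * x + real q * z)
          = x * (real p * x + real q * z) * Q x z
            + ?A * (z ^ (N - 1) * (real p * x + real q * z) + x * (of_int a * x + of_int b * z) ^ (N - 1))"
    using dedekind_decomp_coprime[OF N(2) N2 q cop] unfolding dedekind_decomp_def by blast
  \<comment> \<open>The substitution is homogenised to \<open>(q x, z - p x)\<close> so that
    \<open>int_form_compose\<close> applies; then \<open>z = 1\<close> gives an integer polynomial
    in \<open>t\<close>.\<close>
  have "int_form M (\<lambda>x z. Q (of_int (int q) * x + of_int 0 * z) (of_int (- int p) * x + of_int 1 * z))"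
    using int_form_compose[OF Q int_form_linear[of "int q" 0] int_form_linear[of "- int p" 1]] M by simp
  then obtain c :: "nat \<Rightarrow> int" where "\<And>x z. Q (of_int (int q) * x + of_int 0 * z) (of_int (- int p) * x + of_int 1 * z)
       = (\<Sum>k\<le>M. of_int (c k) * x ^ k * z ^ (M - k))"
    unfolding int_form_def by blast
  from this[of _ 1] have c: "Q (real q * t) (1 - real p * t) = (\<Sum>k\<le>M. of_int (c k) * t ^ k)" for t
    by simp
  define g where "g k = real (N choose k) * ((-1) ^ k * gen_dedekind_sum (N - k) k p q)" for k
  define L where "L k = ?K * real q ^ Suc M * g k" for k
  \<comment> \<open>The summands come from \<open>x y Q\<close>, \<open>(1 - p t) ^ (N - 1)\<close>
    and \<open>t (t + b) ^ (N - 1)\<close>. The first reaches only from \<open>t\<close> to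
    \<open>t ^ (N - 1)\<close>, hence the exceptions at 0 and \<open>N\<close>.\<close>
  define R where "R k = (if k = 0 \<or> k = N then 0 else real q * of_int (c (k - 1)))
      + ?A * (real (Suc M choose k) * (- real p) ^ k
              + (if k = 0 then 0 else real (Suc M choose (k - 1)) * of_int b ^ (N - k)))" for k
  \<comment> \<open>On this interval \<open>x\<close> and \<open>z\<close> are positive, as the
    decomposition requires; being infinite, it suffices for comparing coefficients.\<close>
  have LR: "(\<Sum>k\<le>N. L k * t ^ k) = (\<Sum>k\<le>N. R k * t ^ k)" if t: "t \<in> {0 <..< 1 / real p}" for t
  proof -
    have pos: "real q * t > 0" "1 - real p * t > 0"
      using t p q by (simp_all add: field_simps)
    have y: "real p * (real q * t) + real q * (1 - real p * t) = real q"
      by (simp add: algebra_simps)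
    have "of_int a * (real q * t) + of_int b * (1 - real p * t)
        = of_int (a * int q - b * int p) * t + of_int b"
      by (simp add: algebra_simps)
    then have w: "of_int a * (real q * t) + of_int b * (1 - real p * t) = t + of_int b"
      by (simp add: ab)
    have form: "dedekind_form N p q (real q * t) (real q) = real q ^ N * (\<Sum>k\<le>N. g k * t ^ k)"
      unfolding dedekind_form_def sum_distrib_left
    proof (intro sum.cong refl)
      fix k assume "k \<in> {..N}"
      then have "real q ^ N = real q ^ k * real q ^ (N - k)"
        by (simp flip: power_add)
      then show "real (N choose k) * ((-1) ^ k * gen_dedekind_sum (N - k) k p q) * (real q * t) ^ k * real q ^ (N - k)
            = real q ^ N * (g k * t ^ k)"
        by (simp add: g_def power_mult_distrib)
    qed
    have e: "?K * (real q ^ N * (\<Sum>k\<le>N. g k * t ^ k))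
        = real q * t * real q * (\<Sum>k\<le>M. of_int (c k) * t ^ k)
          + ?A * ((1 - real p * t) ^ Suc M * real q + real q * t * (t + of_int b) ^ Suc M)"
      using eq[OF pos] unfolding y w form c using M by simp
    have lin: "1 - real p * t = - real p * t + 1"
      by simp
    have b1: "(1 - real p * t) ^ Suc M = (\<Sum>k\<le>Suc M. real (Suc M choose k) * (- real p) ^ k * t ^ k)"
      unfolding lin binomial_ring power_mult_distrib power_one by (simp only: mult_1_right mult.assoc)
    have b2: "(t + of_int b) ^ Suc M = (\<Sum>k\<le>Suc M. real (Suc M choose k) * of_int b ^ (Suc M - k) * t ^ k)"
      using binomial_ring[of t "of_int b" "Suc M"] by (simp add: mult_ac)
    have "real q * (\<Sum>k\<le>N. L k * t ^ k) = ?K * (real q ^ N * (\<Sum>k\<le>N. g k * t ^ k))"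
      unfolding L_def M power_Suc sum_distrib_left by (simp only: mult_ac)
    also have "\<dots> = real q * (t * (\<Sum>k\<le>M. real q * of_int (c k) * t ^ k)
          + ?A * ((1 - real p * t) ^ Suc M + t * (t + of_int b) ^ Suc M))"
      unfolding e by (simp add: algebra_simps sum_distrib_left)
    finally have "(\<Sum>k\<le>N. L k * t ^ k) = t * (\<Sum>k\<le>M. real q * of_int (c k) * t ^ k)
          + ?A * ((1 - real p * t) ^ Suc M + t * (t + of_int b) ^ Suc M)"
      using q by simp
    moreover have "(\<Sum>k\<le>N. (if k = 0 \<or> k = N then 0 else real q * of_int (c (k - 1))) * t ^ k)
         = t * (\<Sum>k\<le>M. real q * of_int (c k) * t ^ k)"
    proof -
      have "(\<Sum>k\<le>N. (if k = 0 \<or> k = N then 0 else real q * of_int (c (k - 1))) * t ^ k)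
          = (\<Sum>k\<le>M. (if k = Suc M then 0 else real q * of_int (c k)) * t ^ Suc k)"
        unfolding M by (subst sum.atMost_Suc_shift) simp
      also have "\<dots> = (\<Sum>k\<le>M. t * (real q * of_int (c k) * t ^ k))"
        by (intro sum.cong) auto
      finally show ?thesis
        by (simp only: sum_distrib_left)
    qed
    moreover have "(\<Sum>k\<le>N. real (Suc M choose k) * (- real p) ^ k * t ^ k) = (1 - real p * t) ^ Suc M"
      unfolding M b1 by (subst sum.atMost_Suc) (simp add: binomial_eq_0)
    moreover have "(\<Sum>k\<le>N. (if k = 0 then 0 else real (Suc M choose (k - 1)) * of_int b ^ (N - k)) * t ^ k)
        = t * (t + of_int b) ^ Suc M"
      unfolding M b2 sum_distrib_left
      by (subst sum.atMost_Suc_shift) (auto intro!: sum.cong simp: mult_ac)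
    ultimately show ?thesis
      unfolding R_def distrib_left distrib_right sum.distrib mult.assoc sum_distrib_left[symmetric]
      by simp
  qed
  have inf: "infinite {0 <..< 1 / real p}"
    using p by (simp add: infinite_Ioo)
  have "j \<le> N"
    using N by simp
  have LRj: "L j = R j"
    by (rule polyfun_eq_coeffs_on_infinite[OF inf LR \<open>j \<le> N\<close>])
  have ij': "j - 1 = Suc M - i" "i \<le> Suc M" "N - j = i" "j \<noteq> 0" "j \<noteq> N"
    using M N ij by linarith+
  have sym: "Suc M choose (j - 1) = Suc M choose i"
    unfolding ij'(1) by (rule binomial_symmetric[OF ij'(2), symmetric])
  have e: "?K * real q ^ Suc M * (real (N choose j) * ((-1) ^ j * gen_dedekind_sum i j p q))
      = real q * of_int (c (j - 1)) + ?A * (real (Suc M choose j) * (- real p) ^ j + real (Suc M choose i) * of_int b ^ i)"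
    using LRj unfolding L_def R_def g_def sym using ij' by simp
  \<comment> \<open>As \<open>i\<close> and \<open>j\<close> have the same parity, the single factor
    \<open>(-1) ^ j\<close> turns \<open>(-p) ^ j\<close> into \<open>p ^ j\<close> and
    \<open>b ^ i\<close> into \<open>(-b) ^ i\<close>.\<close>
  have par: "(-1 :: real) ^ j = (-1) ^ i"
    using N by (simp add: minus_one_power_iff)
  have "N choose i = N choose j"
    using binomial_symmetric[of i N] N by simp
  then have "of_int (dedekind_R i j) * real q ^ Suc M * gen_dedekind_sum i j p q
      = (-1) ^ j * (?K * real q ^ Suc M * (real (N choose j) * ((-1) ^ j * gen_dedekind_sum i j p q)))"
    unfolding dedekind_R_def N(1)[symmetric] by (simp flip: power_mult_distrib)
  also have "\<dots> = real q * ((-1) ^ j * of_int (c (j - 1)))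
      + ?A * (real (Suc M choose j) * ((-1) ^ j * (- real p) ^ j) + real (Suc M choose i) * ((-1) ^ i * of_int b ^ i))"
    unfolding e by (simp add: algebra_simps par)
  also have "\<dots> = of_int (int q * ((-1) ^ j * c (j - 1)) + bern_numer N * bern_lcm N
                   * (int ((N - 1) choose j) * int p ^ j + int ((N - 1) choose i) * (- b) ^ i))"
    unfolding M by (simp flip: power_mult_distrib)
  finally have "of_int (dedekind_R i j) * real q ^ (N - 1) * gen_dedekind_sum i j p q = \<dots>"
    using M by simp
  moreover have "- b * int p - 1 = int q * (- a)"
    using ab by (simp add: algebra_simps)
  then have "[- b * int p = 1] (mod int q)"
    by (simp only: cong_iff_dvd_diff dvd_triv_left)
  ultimately show ?thesis
    using that by blast
qed

theorem theorem1p1: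
  fixes i j N p q :: nat and p' :: int
  assumes "i \<ge> 1" and "j \<ge> 1"
    and "N = i + j" and "even N"
    and "p > 0" and "q > 0" and "coprime p q" and "p < q"
    and "[p' * int p = 1] (mod int q)"
  shows "of_int (dedekind_R i j) * real q ^ (N - 2) * gen_dedekind_sum i j p q
         - of_int (p' ^ i * bern_numer N * bern_lcm N * int ((N - 1) choose i)
                   + int p ^ j * bern_numer N * bern_lcm N * int ((N - 1) choose j)) / real q
         \<in> \<int>"
proof -
  define A where "A = bern_numer N * bern_lcm N"
  obtain b m where b: "[- b * int p = 1] (mod int q)"
    and e: "of_int (dedekind_R i j) * real q ^ (N - 1) * gen_dedekind_sum i j p q
       = of_int (int q * m + A * (int ((N - 1) choose j) * int p ^ j + int ((N - 1) choose i) * (- b) ^ i))"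
    using dedekind_sum_eq_int_plus_polar[OF assms(1-7)] unfolding A_def by blast
  \<comment> \<open>Both \<open>-b\<close> and \<open>p'\<close> invert \<open>p\<close> modulo
    \<open>q\<close>, so they are congruent; exchanging them changes the numerator by a multiple of
    \<open>q\<close> and the fraction by an integer.\<close>
  have "[- b * int p = p' * int p] (mod int q)"
    using b assms(9) by (meson cong_sym cong_trans)
  then have "[- b = p'] (mod int q)"
    using assms(7) by (subst (asm) cong_mult_rcancel) auto
  then have "[(- b) ^ i = p' ^ i] (mod int q)"
    by (rule cong_pow)
  then obtain k where "(- b) ^ i = p' ^ i + int q * k"
    by (metis cong_iff_lin cong_sym)
  then have "of_int (dedekind_R i j) * real q ^ (N - 1) * gen_dedekind_sum i j p q
       = real_of_int (p' ^ i * A * int ((N - 1) choose i) + int p ^ j * A * int ((N - 1) choose j))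
         + real q * of_int (m + A * int ((N - 1) choose i) * k)"
    unfolding e by (simp add: algebra_simps)
  moreover have "N - 1 = Suc (N - 2)"
    using assms(1-3) by simp
  then have "real q ^ (N - 1) = real q * real q ^ (N - 2)"
    by (simp only: power_Suc)
  ultimately have "of_int (dedekind_R i j) * real q ^ (N - 2) * gen_dedekind_sum i j p q
         - of_int (p' ^ i * A * int ((N - 1) choose i) + int p ^ j * A * int ((N - 1) choose j)) / real q
       = of_int (m + A * int ((N - 1) choose i) * k)"
    using assms(6) by (simp add: field_simps)
  then show ?thesis
    unfolding A_def mult.assoc by (metis Ints_of_int)
qed

end
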